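(* Let $L$ and $s$ be positive integers with $L \ge 3$ and $L \ge s+1$. Then for every integer $N \ge \Gamma(s)$, the coefficient of $q^N$ in $H_{L,s,L}(q)$ is greater than or equal to $\left\lfloor \frac{N-10s}{(s+2)(s+3)} \right\rfloor$.
   Context: $(a;q)_n := (1-a)(1-aq)\cdots(1-aq^{n-1})$. For positive integers $L,s,k$, $H_{L,s,k}(q) := \frac{q^s(1-q^k)}{(q^s;q)_{L+1}} - \left(\frac{1}{(q^{s+1};q)_L}-1\right)$. Let $P_{L,s} = (s+1)(s+2)\cdots(s+L)$, $$\gamma(L,s) = \big((s+1)+\cdots+(s+L)\big)\cdot\Big(P_{L,s}^{(P_{L,s}^2-1)L+2} + \big((P_{L,s}^2-1)L-2\big)P_{L,s}\Big),$$ and $\Gamma(s) = \gamma(3s+2,s)$. *)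

theory Defs
  imports "HOL-Computational_Algebra.Formal_Power_Series"
begin

definition qpoch :: "'a::comm_ring_1 \<Rightarrow> 'a \<Rightarrow> nat \<Rightarrow> 'a" where
  "qpoch a q n = (\<Prod>i<n. 1 - a * q ^ i)"

text \<open>
  The rational function of \<open>q\<close> is taken as a formal power series over the rationals, \<open>q\<close> being
  \<^const>\<open>fps_X\<close>. For positive \<open>s\<close> both denominators have constant term \<open>1\<close>, so the divisions are
  genuine ones by units.
\<close>

definition H :: "nat \<Rightarrow> nat \<Rightarrow> nat \<Rightarrow> rat fps" where
  "H L s k =
     fps_X ^ s * (1 - fps_X ^ k) / qpoch (fps_X ^ s) fps_X (L + 1)
     - (1 / qpoch (fps_X ^ (s + 1)) fps_X L - 1)"

definition P :: "nat \<Rightarrow> nat \<Rightarrow> nat" where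
  "P L s = (\<Prod>i=1..L. s + i)"

text \<open>
  The exponent is a natural number, and its subtraction never truncates because \<open>P L s \<ge> 1\<close>;
  everything else is computed in the integers, where \<open>- 2\<close> is exact.
\<close>

definition gamma_bound :: "nat \<Rightarrow> nat \<Rightarrow> int" where
  "gamma_bound L s =
     int (\<Sum>i=1..L. s + i) *
       (int (P L s) ^ (((P L s)\<^sup>2 - 1) * L + 2)
        + (((int (P L s))\<^sup>2 - 1) * int L - 2) * int (P L s))"

definition Gamma_bound :: "nat \<Rightarrow> int" where
  "Gamma_bound s = gamma_bound (3 * s + 2) s"

end

theory Submission
  imports Defs
begin

text \<open>
  Write \<open>geo d = 1 / (1 - q^d)\<close> and pick two parts \<open>a, b\<close> among \<open>S = {s + 1..s + L} - {L}\<close>. Then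
  \<open>H = 1 + g * C\<close> with \<open>g = geo a * geo b * (q^s * geo s - geo L)\<close> and \<open>C\<close> the product of \<open>geo x\<close>
  over the other parts \<open>x\<close> of \<open>S\<close>. As \<open>s < L\<close>, the coefficients of \<open>g\<close> grow quadratically, at a
  rate bounded below in terms of \<open>s\<close> only, so only boundedly many of them are negative.

  A negative coefficient at a small \<open>m\<close> contributes a multiple of the number \<open>c (N - m)\<close> of
  partitions counted by \<open>C\<close>. If \<open>N\<close> is large, such a partition contains some part \<open>x\<close> with total
  size at least \<open>M\<close>; deleting just enough copies of \<open>x\<close> bounds \<open>c (N - m)\<close> by a sum of terms
  \<open>c (N - k)\<close> with \<open>k \<ge> M\<close>, in which each \<open>k\<close> occurs at most \<open>k\<close> times. These are absorbed by the
  positive coefficients of \<open>g\<close> at \<open>k\<close>, which exceed any given multiple of \<open>k\<close>. The same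
  coefficients leave at least \<open>N\<close> over at \<open>k = N\<close>. All thresholds are polynomial in \<open>s\<close>, hence far
  below \<open>\<Gamma>(s)\<close>.
\<close>

section \<open>Geometric series and the coefficientwise order\<close>

text \<open>Defined by coefficients, so that signs and comparisons can be read off;
  \<open>geo_mult_one_minus\<close> identifies it with 1 / (1 - q^d) for d > 0.\<close>

definition geo :: "nat \<Rightarrow> rat fps" where
  "geo d = Abs_fps (\<lambda>n. if d dvd n then 1 else 0)"

definition fps_le :: "rat fps \<Rightarrow> rat fps \<Rightarrow> bool" (infix "\<preceq>" 50) where
  "f \<preceq> g \<longleftrightarrow> (\<forall>n. fps_nth f n \<le> fps_nth g n)"

lemma geo_nth [simp]: "fps_nth (geo d) n = (if d dvd n then 1 else 0)"
  by (simp add: geo_def)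

lemma geo_mult_one_minus:
  assumes "d > 0"
  shows "geo d * (1 - fps_X ^ d) = 1"
proof (rule fps_ext)
  fix n
  have "geo d * (1 - fps_X ^ d) = geo d - fps_X ^ d * geo d"
    by (simp add: algebra_simps)
  then show "fps_nth (geo d * (1 - fps_X ^ d)) n = fps_nth (1 :: rat fps) n"
    using assms by (auto simp: fps_X_power_mult_nth dvd_imp_le dvd_minus_self)
qed

lemma fps_le_refl: "f \<preceq> f"
  by (simp add: fps_le_def)

lemma fps_le_trans: "f \<preceq> g \<Longrightarrow> g \<preceq> h \<Longrightarrow> f \<preceq> h"
  unfolding fps_le_def by (meson order_trans)

lemma fps_le_add: "f \<preceq> g \<Longrightarrow> f' \<preceq> g' \<Longrightarrow> f + f' \<preceq> g + g'"
  by (simp add: fps_le_def add_mono)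

lemma fps_le_sum: "(\<And>x. x \<in> A \<Longrightarrow> f x \<preceq> g x) \<Longrightarrow> sum f A \<preceq> sum g A"
  by (simp add: fps_le_def fps_sum_nth sum_mono)

lemma fps_le_mult_left: "0 \<preceq> h \<Longrightarrow> f \<preceq> g \<Longrightarrow> h * f \<preceq> h * g"
  by (auto simp: fps_le_def fps_mult_nth intro!: sum_mono mult_left_mono)

lemma fps_nonneg_prod: "(\<And>x. x \<in> A \<Longrightarrow> 0 \<preceq> f x) \<Longrightarrow> 0 \<preceq> prod f A"
proof (induction A rule: infinite_finite_induct)
  case (insert x A)
  then show ?case
    using fps_le_mult_left[of "f x" 0 "prod f A"] by simp
qed (auto simp: fps_le_def)

lemma geo_nonneg: "0 \<preceq> geo d"
  by (simp add: fps_le_def)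

lemma fps_X_power_nonneg: "0 \<preceq> fps_X ^ k"
  by (simp add: fps_le_def fps_X_power_nth)

section \<open>Truncated geometric series and a shift bound for partition numbers\<close>

definition geo_trunc :: "nat \<Rightarrow> nat \<Rightarrow> rat fps" where
  "geo_trunc M d = Abs_fps (\<lambda>n. if d dvd n \<and> n \<le> M then 1 else 0)"

text \<open>The exponent \<open>d * (M div d + 1)\<close> is the least multiple of d above M, so the
  multiples of d beyond M are this one plus arbitrary multiples of d.\<close>

lemma geo_split:
  assumes "d > 0"
  shows "geo d = geo_trunc M d + fps_X ^ (d * (M div d + 1)) * geo d"
proof (rule fps_ext)
  fix n
  have "n < d * (M div d + 1) \<longleftrightarrow> n \<le> M" if "d dvd n"
  proof -
    from that obtain k where k: "n = d * k" ..
    have "n < d * (M div d + 1) \<longleftrightarrow> k \<le> M div d"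
      using assms by (auto simp: k simp del: mult_Suc_right)
    also have "\<dots> \<longleftrightarrow> n \<le> M"
      using assms by (simp add: k less_eq_div_iff_mult_less_eq mult.commute)
    finally show ?thesis .
  qed
  moreover have "d dvd n - d * (M div d + 1) \<longleftrightarrow> d dvd n" if "\<not> n < d * (M div d + 1)"
    using that by (metis dvd_diff_nat dvd_diffD dvd_triv_left not_less)
  ultimately show "fps_nth (geo d) n
      = fps_nth (geo_trunc M d + fps_X ^ (d * (M div d + 1)) * geo d) n"
    by (auto simp: geo_trunc_def fps_X_power_mult_nth simp del: mult_Suc_right)
qed

lemma geo_trunc_nonneg: "0 \<preceq> geo_trunc M d"
  by (simp add: fps_le_def geo_trunc_def)

lemma geo_trunc_le_geo: "geo_trunc M d \<preceq> geo d"
  by (simp add: fps_le_def geo_trunc_def)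

text \<open>A factor with x <= M has degree at most M. A factor with x > M is 1, because 0 is the
  only multiple of x up to M.\<close>

lemma prod_geo_trunc_nth_eq_0:
  assumes "finite R" "\<forall>x\<in>R. x > 0" "n > M * card (R \<inter> {1..M})"
  shows "fps_nth (prod (geo_trunc M) R) n = 0"
  using assms
proof (induction R arbitrary: n rule: finite_induct)
  case (insert x R)
  have "fps_nth (geo_trunc M x) i * fps_nth (prod (geo_trunc M) R) (n - i) = 0" if "i \<le> n" for i
  proof (cases "i \<le> M \<and> x dvd i")
    case True
    have "n - i > M * card (R \<inter> {1..M})"
    proof (cases "x \<le> M")
      case xM: True
      have "insert x R \<inter> {1..M} = insert x (R \<inter> {1..M})"
        using xM insert.prems by auto
      then have "card (insert x R \<inter> {1..M}) = Suc (card (R \<inter> {1..M}))"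
        using insert.hyps by simp
      then have "M + M * card (R \<inter> {1..M}) < n"
        using insert.prems(2) by simp
      then show ?thesis
        using True by linarith
    next
      case False
      then have "i = 0" using True by (meson dvd_imp_le le_trans not_gr_zero)
      moreover have "insert x R \<inter> {1..M} = R \<inter> {1..M}"
        using False by auto
      ultimately show ?thesis
        using insert.prems by simp
    qed
    then show ?thesis
      using insert by simp
  qed (auto simp: geo_trunc_def)
  then have "(\<Sum>i=0..n. fps_nth (geo_trunc M x) i * fps_nth (prod (geo_trunc M) R) (n - i)) = 0"
    by (intro sum.neutral) auto
  then show ?case
    using insert.hyps by (simp add: fps_mult_nth)
qed simp

text \<open>In a partition either every part has total size at most M, or some part x exceeds M in
  total; deleting the smallest block of copies of x above M leaves an arbitrary partition.
  Partitions with several such x are counted repeatedly, hence only an inequality.\<close>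

lemma prod_geo_le:
  assumes "finite R" "\<forall>x\<in>R. x > 0"
  shows "prod geo R \<preceq> prod (geo_trunc M) R
    + (\<Sum>x\<in>R. fps_X ^ (x * (M div x + 1)) * prod geo R)"
  using assms
proof (induction R rule: finite_induct)
  case (insert x R)
  define e where "e = (\<lambda>x. x * (M div x + 1))"
  define t where "t = geo_trunc M x"
  define C where "C = prod geo R"
  have Cnn: "0 \<preceq> C"
    unfolding C_def by (intro fps_nonneg_prod geo_nonneg)
  have IH: "C \<preceq> prod (geo_trunc M) R + (\<Sum>y\<in>R. fps_X ^ e y * C)"
    using insert by (simp add: C_def e_def)
  have "t * C \<preceq> t * (prod (geo_trunc M) R + (\<Sum>y\<in>R. fps_X ^ e y * C))"
    unfolding t_def by (intro fps_le_mult_left geo_trunc_nonneg IH)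
  also have "t * (prod (geo_trunc M) R + (\<Sum>y\<in>R. fps_X ^ e y * C))
      = t * prod (geo_trunc M) R + (\<Sum>y\<in>R. fps_X ^ e y * (C * t))"
    by (simp add: distrib_left sum_distrib_left mult_ac)
  finally have 1: "t * C \<preceq> t * prod (geo_trunc M) R + (\<Sum>y\<in>R. fps_X ^ e y * (C * t))" .
  have "(\<Sum>y\<in>R. fps_X ^ e y * (C * t)) \<preceq> (\<Sum>y\<in>R. fps_X ^ e y * (C * geo x))"
    unfolding t_def
    by (intro fps_le_sum fps_le_mult_left fps_X_power_nonneg Cnn geo_trunc_le_geo)
  then have 2: "t * C \<preceq> t * prod (geo_trunc M) R + (\<Sum>y\<in>R. fps_X ^ e y * (C * geo x))"
    by (intro fps_le_trans[OF 1] fps_le_add fps_le_refl)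
  have "geo x * C = t * C + fps_X ^ e x * (C * geo x)"
  proof -
    have "geo x = t + fps_X ^ e x * geo x"
      unfolding t_def e_def using insert.prems by (intro geo_split) auto
    then have "geo x * C = (t + fps_X ^ e x * geo x) * C" by (rule arg_cong)
    also have "\<dots> = t * C + fps_X ^ e x * (C * geo x)" by (simp add: algebra_simps)
    finally show ?thesis .
  qed
  also have "\<dots> \<preceq> (t * prod (geo_trunc M) R + (\<Sum>y\<in>R. fps_X ^ e y * (C * geo x)))
      + fps_X ^ e x * (C * geo x)"
    by (intro fps_le_add 2 fps_le_refl)
  also have "\<dots> = t * prod (geo_trunc M) R
      + (\<Sum>y\<in>insert x R. fps_X ^ e y * (geo x * C))"
    using insert.hyps by (simp add: algebra_simps)
  finally show ?case
    using insert.hyps by (simp add: t_def C_def e_def)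
qed (simp add: fps_le_refl)

text \<open>Since n - m > M^2, the truncated product in \<open>prod_geo_le\<close> contributes
  nothing. A remaining shift k = m + e x satisfies x <= e x <= k, so at most k parts share it; this
  keeps the bound independent of the size of R.\<close>

lemma prod_geo_shift_le:
  fixes R :: "nat set" and n m M :: nat
  defines "c \<equiv> fps_nth (prod geo R)"
  assumes R: "finite R" "\<forall>x\<in>R. x > 0" and n: "n > M\<^sup>2 + m"
  shows "c (n - m) \<le> (\<Sum>k=M..n. of_nat k * c (n - k))"
proof -
  define e where "e = (\<lambda>x. x * (M div x + 1))"
  have e_ge: "M \<le> e x" "x \<le> e x" if "x \<in> R" for x
  proof -
    have "x > 0" using that R by auto
    then have "M < e x" unfolding e_def
      by (metis add.commute dividend_less_times_div plus_1_eq_Suc mult_Suc_right)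
    then show "M \<le> e x" by simp
  qed (simp add: e_def)
  have c_nonneg: "c k \<ge> 0" for k
    using fps_nonneg_prod[of R geo] geo_nonneg by (simp add: c_def fps_le_def)
  have "M * card (R \<inter> {1..M}) \<le> M * M"
    by (intro mult_left_mono) (use card_mono[of "{1..M}" "R \<inter> {1..M}"] in auto)
  then have "fps_nth (prod (geo_trunc M) R) (n - m) = 0"
    using n R unfolding power2_eq_square by (intro prod_geo_trunc_nth_eq_0) linarith+
  then have "c (n - m) \<le> (\<Sum>x\<in>R. if n - m < e x then 0 else c (n - m - e x))"
    using prod_geo_le[OF R, of M, unfolded fps_le_def, rule_format, of "n - m"]
    by (simp add: c_def e_def fps_sum_nth fps_X_power_mult_nth del: mult_Suc_right cong: if_cong)
  also have "\<dots> = (\<Sum>x\<in>{x\<in>R. e x \<le> n - m}. c (n - m - e x))"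
    using R(1) by (subst sum.inter_filter) (auto intro!: sum.cong)
  \<comment> \<open>The part x goes to the pair (m + e x, x); keeping x as second component makes
    the map injective.\<close>
  also have "\<dots> \<le> (\<Sum>p\<in>(SIGMA k:{M..n}. {1..k}). c (n - fst p))"
  proof (rule sum_le_included[where i = snd])
    show "\<forall>x\<in>{x\<in>R. e x \<le> n - m}. \<exists>p\<in>(SIGMA k:{M..n}. {1..k}).
        snd p = x \<and> c (n - m - e x) \<le> c (n - fst p)"
    proof
      fix x assume "x \<in> {x\<in>R. e x \<le> n - m}"
      then have x: "x \<in> R" "e x \<le> n - m" by auto
      have "(m + e x, x) \<in> (SIGMA k:{M..n}. {1..k})"
        using x e_ge[OF x(1)] R n by (auto simp: Suc_le_eq)
      then show "\<exists>p\<in>(SIGMA k:{M..n}. {1..k}). snd p = x \<and> c (n - m - e x) \<le> c (n - fst p)"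
        by (intro bexI[of _ "(m + e x, x)"]) auto
    qed
  qed (use R c_nonneg in auto)
  also have "\<dots> = (\<Sum>k=M..n. \<Sum>x=1..k. c (n - k))"
    by (subst sum.Sigma) (auto simp: case_prod_beta)
  finally show ?thesis by simp
qed

section \<open>Absorbing the negative coefficients\<close>

lemma mult_prod_geo_nth_ge:
  fixes g :: "rat fps" and \<kappa> N :: nat
  assumes R: "finite R" "\<forall>x\<in>R. x > 0"
    and g: "\<And>m. fps_nth g m \<ge> (of_nat m)\<^sup>2 / of_nat \<kappa> - 4 * of_nat m - 2"
    and \<kappa>: "\<kappa> \<ge> 1" and N: "N \<ge> 6247 * \<kappa> ^ 6"
  shows "fps_nth (g * prod geo R) N \<ge> of_nat N"
proof -
  define c where "c = fps_nth (prod geo R)"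
  have c_nonneg: "c k \<ge> 0" for k
    using fps_nonneg_prod[of R geo] geo_nonneg by (simp add: c_def fps_le_def)
  have c0: "c 0 = 1"
    using R(1) by (simp add: c_def) (induction R rule: finite_induct; simp)
  \<comment> \<open>From M0 on, m^2 / \<kappa> >= 6 m >= 4 m + 2, so g is nonnegative. W is the
    total of the deficits \<open>w m\<close> below M0. From M on, m^2 / \<kappa> >= (W + 7) m, which
    leaves at least (W + 1) m.\<close>
  define M0 where "M0 = 6 * \<kappa>"
  define W where "W = 2 * M0\<^sup>2"
  define M where "M = \<kappa> * (W + 7)"
  define w :: "nat \<Rightarrow> rat" where "w = (\<lambda>m. 4 * of_nat m + 2)"
  have sum_w: "(\<Sum>m<n. w m) = 2 * of_nat n ^ 2" for n
    by (induction n) (auto simp: w_def power2_eq_square algebra_simps)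
  have g_ge: "fps_nth g m \<ge> of_nat q * of_nat m - 4 * of_nat m - 2" if "m \<ge> \<kappa> * q" for m q
  proof -
    have "of_nat q * of_nat \<kappa> \<le> (of_nat m :: rat)"
      using that by (metis of_nat_le_iff of_nat_mult mult.commute)
    then have "of_nat q * of_nat m \<le> (of_nat m)\<^sup>2 / (of_nat \<kappa> :: rat)"
      using \<kappa> mult_right_mono[of "of_nat q * of_nat \<kappa>" "of_nat m" "of_nat m :: rat"]
      by (simp add: pos_le_divide_eq power2_eq_square mult_ac)
    then show ?thesis using g[of m] by linarith
  qed
  have M_le: "M \<le> 79 * \<kappa> ^ 3"
  proof -
    have "\<kappa> \<le> \<kappa> ^ 3" using \<kappa> by (simp add: self_le_power)
    moreover have "M = 72 * \<kappa> ^ 3 + 7 * \<kappa>"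
      by (simp add: M_def W_def M0_def power2_eq_square power3_eq_cube algebra_simps)
    ultimately show ?thesis by linarith
  qed
  \<comment> \<open>The constant 6247 is 79^2 + 6: M^2 is at most 79^2 \<kappa>^6 and M0 at most 6
    \<kappa>^6.\<close>
  have "1 \<le> \<kappa> ^ 6" "\<kappa> \<le> \<kappa> ^ 6"
    using \<kappa> by (simp_all add: self_le_power)
  moreover have "M\<^sup>2 \<le> 6241 * \<kappa> ^ 6"
    using power_mono[OF M_le, of 2] by (simp add: power_mult_distrib flip: power_mult)
  ultimately have N_gt: "M\<^sup>2 + M0 \<le> N"
    using N by (simp add: M0_def)
  have M0_M: "M0 \<le> M" "0 < M"
    using \<kappa> by (simp_all add: M0_def M_def algebra_simps)
  have "M \<le> M\<^sup>2"
    using M0_M by (simp add: power2_eq_square)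
  then have MN: "M \<le> N" using N_gt by linarith
  define F where "F = (\<Sum>k=M..N. of_nat k * c (N - k))"
  \<comment> \<open>The term k = N alone contributes N, as \<open>c 0 = 1\<close>.\<close>
  have F_ge: "of_nat N \<le> F"
  proof -
    have "of_nat N * c (N - N) \<le> F"
      unfolding F_def using MN c_nonneg
      by (intro member_le_sum[of N _ "\<lambda>k. of_nat k * c (N - k)"]) auto
    then show ?thesis by (simp add: c0)
  qed
  have c_le_F: "c (N - i) \<le> F" if "i < M0" for i
    unfolding c_def F_def using that N_gt R by (intro prod_geo_shift_le) auto
  have pointwise: "(if M \<le> i then of_nat (W + 1) * of_nat i else 0) - (if i < M0 then w i else 0)
      \<le> fps_nth g i" for i
  proof -
    consider "i < M0" | "M0 \<le> i" "i < M" | "M \<le> i" by linarith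
    then show ?thesis
    proof cases
      case 1
      then show ?thesis using g_ge[of 0 i] M0_M by (simp add: w_def)
    next
      case 2
      then have "(1::rat) \<le> of_nat i" using \<kappa> by (simp add: M0_def)
      then show ?thesis using 2 g_ge[of 6 i] by (simp add: M0_def mult.commute)
    next
      case 3
      then have "(1::rat) \<le> of_nat i" using M0_M by simp
      have "of_nat (W + 7) * of_nat i - 4 * of_nat i - 2 \<le> fps_nth g i"
        using 3 by (intro g_ge) (simp add: M_def)
      moreover have "of_nat (W + 7) * of_nat i = of_nat (W + 1) * of_nat i + 6 * (of_nat i :: rat)"
        by (simp add: algebra_simps)
      ultimately show ?thesis
        using 3 M0_M \<open>1 \<le> of_nat i\<close> by simp
    qed
  qed
  have "(\<Sum>i<M0. w i * c (N - i)) \<le> (\<Sum>i<M0. w i * F)"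
    using c_le_F by (intro sum_mono mult_left_mono) (auto simp: w_def)
  also have "\<dots> = of_nat W * F"
    by (simp add: sum_distrib_right[symmetric] sum_w W_def)
  finally have neg: "(\<Sum>i<M0. w i * c (N - i)) \<le> of_nat W * F" .
  have "(\<Sum>i=0..N. (if M \<le> i then of_nat (W + 1) * of_nat i else 0) * c (N - i))
      = (\<Sum>i=M..N. of_nat (W + 1) * of_nat i * c (N - i))"
    by (rule sum.mono_neutral_cong_right) auto
  then have pos_part: "(\<Sum>i=0..N. (if M \<le> i then of_nat (W + 1) * of_nat i else 0) * c (N - i))
      = of_nat (W + 1) * F"
    by (simp add: F_def sum_distrib_left mult.assoc)
  have neg_part: "(\<Sum>i=0..N. (if i < M0 then w i else 0) * c (N - i))
      = (\<Sum>i<M0. w i * c (N - i))"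
    using MN M0_M by (intro sum.mono_neutral_cong_right) auto
  \<comment> \<open>The deficits cost at most W F out of (W + 1) F, and the remaining F is at least
    N.\<close>
  have "of_nat N \<le> of_nat (W + 1) * F - (\<Sum>i<M0. w i * c (N - i))"
    using F_ge neg by (simp add: algebra_simps)
  also have "\<dots> = (\<Sum>i=0..N. ((if M \<le> i then of_nat (W + 1) * of_nat i else 0)
      - (if i < M0 then w i else 0)) * c (N - i))"
    by (simp only: left_diff_distrib sum_subtractf pos_part neg_part)
  also have "\<dots> \<le> (\<Sum>i=0..N. fps_nth g i * c (N - i))"
    by (intro sum_mono mult_right_mono pointwise c_nonneg)
  also have "\<dots> = fps_nth (g * prod geo R) N"
    by (simp add: fps_mult_nth c_def)
  finally show ?thesis .
qed

section \<open>Quadratic bounds for products of three geometric series\<close>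

text \<open>
  A representation \<open>n = a * u + (a + 1) * v\<close> is determined by \<open>t = u + v\<close>, which ranges over the
  integers with \<open>a * t \<le> n \<le> (a + 1) * t\<close>.
\<close>

lemma geo_mult_geo_Suc_nth:
  assumes "a > 0"
  shows "fps_nth (geo a * geo (Suc a)) n = of_nat (card {(n + a) div Suc a..n div a})"
proof -
  \<comment> \<open>The lower end \<open>(n + a) div Suc a\<close> is n / (a + 1) rounded
    up.\<close>
  have iff: "t \<in> {(n + a) div Suc a..n div a} \<longleftrightarrow> n \<le> Suc a * t \<and> a * t \<le> n" for t
  proof -
    have "(n + a) div Suc a \<le> t \<longleftrightarrow> n + a < Suc a * Suc t"
      by (metis div_less_iff_less_mult less_Suc_eq_le mult.commute zero_less_Suc)
    moreover have "t \<le> n div a \<longleftrightarrow> a * t \<le> n"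
      using assms by (simp add: less_eq_div_iff_mult_less_eq mult.commute)
    ultimately show ?thesis by auto
  qed
  \<comment> \<open>Solving u + v = t and a u + (a + 1) v = n gives u = (a + 1) t - n; the index i
    is the size a u.\<close>
  have "bij_betw (\<lambda>t. a * (Suc a * t - n)) {(n + a) div Suc a..n div a}
      {i \<in> {0..n}. a dvd i \<and> Suc a dvd n - i}"
  proof (intro bij_betwI')
    fix t t' assume "t \<in> {(n + a) div Suc a..n div a}" "t' \<in> {(n + a) div Suc a..n div a}"
    then have "n \<le> Suc a * t" "n \<le> Suc a * t'"
      using iff by blast+
    then have "Suc a * t - n = Suc a * t' - n \<longleftrightarrow> Suc a * t = Suc a * t'"
      by linarith
    then show "(a * (Suc a * t - n) = a * (Suc a * t' - n)) = (t = t')"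
      using assms by (simp del: mult_Suc)
  next
    fix t assume "t \<in> {(n + a) div Suc a..n div a}"
    then have t: "n \<le> Suc a * t" "a * t \<le> n"
      using iff by blast+
    then obtain k l where k: "Suc a * t = n + k" and l: "n = a * t + l"
      by (metis le_Suc_ex)
    then have "t = l + k" by simp
    then have n: "n = a * k + Suc a * l" by (simp add: l algebra_simps)
    moreover have "Suc a * t - n = k" using k by linarith
    moreover have "n - a * k = Suc a * l" using n by linarith
    ultimately show "a * (Suc a * t - n) \<in> {i \<in> {0..n}. a dvd i \<and> Suc a dvd n - i}"
      by (metis (mono_tags, lifting) atLeastAtMost_iff dvd_triv_left le_add1 mem_Collect_eq zero_le)
  next
    fix i assume "i \<in> {i \<in> {0..n}. a dvd i \<and> Suc a dvd n - i}"
    then have i: "i \<le> n" "a dvd i" "Suc a dvd n - i" by auto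
    then obtain u v where uv: "i = a * u" "n - i = Suc a * v" by (elim dvdE)
    then have n: "n = a * u + Suc a * v" using i by linarith
    show "\<exists>t\<in>{(n + a) div Suc a..n div a}. i = a * (Suc a * t - n)"
    proof
      show "u + v \<in> {(n + a) div Suc a..n div a}"
        unfolding iff by (simp add: n algebra_simps)
      show "i = a * (Suc a * (u + v) - n)"
        by (simp add: n uv(1) algebra_simps)
    qed
  qed
  then have "card {i \<in> {0..n}. a dvd i \<and> Suc a dvd n - i} = card {(n + a) div Suc a..n div a}"
    by (rule bij_betw_same_card[symmetric])
  moreover have "fps_nth (geo a * geo (Suc a)) n
      = (\<Sum>i\<in>{0..n}. if a dvd i \<and> Suc a dvd n - i then 1 else 0)"
    by (auto simp: fps_mult_nth intro!: sum.cong)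
  ultimately show ?thesis
    by (simp flip: sum.inter_filter)
qed

text \<open>The interval of admissible t has real endpoints n / (a + 1) and n / a, at distance n /
  (a (a + 1)); counting integers in it changes this by at most 1.\<close>

lemma geo_mult_geo_Suc_bounds:
  assumes "a > 0"
  defines "c \<equiv> fps_nth (geo a * geo (Suc a))"
  shows "c n \<ge> of_nat n / of_nat (a * Suc a) - 1" "c n \<le> of_nat n / of_nat (a * Suc a) + 1"
proof -
  define x :: rat where "x = of_nat (n div a)"
  define y :: rat where "y = of_nat ((n + a) div Suc a)"
  have c: "c n = of_nat (Suc (n div a) - (n + a) div Suc a)"
    using assms by (simp add: geo_mult_geo_Suc_nth)
  have "a * (n div a) \<le> n" "n < a * Suc (n div a)"
    using assms dividend_less_times_div[of a n] by simp_all
  then have "of_nat (a * (n div a)) \<le> (of_nat n :: rat)"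
      "(of_nat n :: rat) \<le> of_nat (a * Suc (n div a))"
    by (simp_all only: of_nat_le_iff less_imp_le)
  then have x: "x \<le> of_nat n / of_nat a" "of_nat n / of_nat a \<le> x + 1"
    using assms by (simp_all add: x_def field_simps)
  have "Suc a * ((n + a) div Suc a) \<le> n + a" "n + a < Suc a * Suc ((n + a) div Suc a)"
    using dividend_less_times_div[of "Suc a" "n + a"] by (simp_all del: mult_Suc)
  then have "Suc a * ((n + a) div Suc a) \<le> n + Suc a" "n \<le> Suc a * ((n + a) div Suc a)"
    by simp_all
  then have "of_nat (Suc a * ((n + a) div Suc a)) \<le> (of_nat (n + Suc a) :: rat)"
      "(of_nat n :: rat) \<le> of_nat (Suc a * ((n + a) div Suc a))"
    by (simp_all only: of_nat_le_iff)
  then have y: "y \<le> of_nat n / of_nat (Suc a) + 1" "of_nat n / of_nat (Suc a) \<le> y"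
    by (simp_all add: y_def field_simps)
  have d: "of_nat n / of_nat (a * Suc a) = (of_nat n / of_nat a - of_nat n / of_nat (Suc a) :: rat)"
    using assms by (simp add: field_simps)
  have "x + 1 - y \<le> c n"
    unfolding c x_def y_def
    by (cases "(n + a) div Suc a \<le> Suc (n div a)") (auto simp: of_nat_diff)
  then show "c n \<ge> of_nat n / of_nat (a * Suc a) - 1"
    unfolding d using x y by linarith
  \<comment> \<open>Natural subtraction may truncate here; then the count is 0, which is below the
    bound anyway.\<close>
  have "c n \<le> x + 1 - y \<or> c n = 0"
    unfolding c x_def y_def by (cases "(n + a) div Suc a \<le> Suc (n div a)") (auto simp: of_nat_diff)
  moreover have "0 \<le> (of_nat n / of_nat (a * Suc a) :: rat)" by simp
  ultimately show "c n \<le> of_nat n / of_nat (a * Suc a) + 1"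
    unfolding d using x y by linarith
qed

lemma mult_geo_nth:
  assumes "d > 0"
  shows "fps_nth (f * geo d) m = (\<Sum>j\<le>m div d. fps_nth f (m - d * j))"
proof -
  have "fps_nth (f * geo d) m = fps_nth (geo d * f) m"
    by (simp add: mult.commute)
  also have "\<dots> = (\<Sum>i=0..m. if d dvd i then fps_nth f (m - i) else 0)"
    by (auto simp: fps_mult_nth intro!: sum.cong)
  also have "\<dots> = (\<Sum>i\<in>{i\<in>{0..m}. d dvd i}. fps_nth f (m - i))"
    by (subst sum.inter_filter) auto
  also have "\<dots> = (\<Sum>j\<le>m div d. fps_nth f (m - d * j))"
  proof (rule sum.reindex_bij_witness[of _ "\<lambda>j. d * j" "\<lambda>i. i div d"])
    fix j assume "j \<in> {..m div d}"
    then have "d * j \<le> m"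
      using assms by (simp add: less_eq_div_iff_mult_less_eq mult.commute)
    then show "d * j \<in> {i \<in> {0..m}. d dvd i}" by simp
  qed (use assms in \<open>auto simp: div_le_mono\<close>)
  finally show ?thesis .
qed

text \<open>The linear bounds are summed over m, m - d, m - 2 d, ...: the main terms form an
  arithmetic series, and the at most m + 1 rounding errors are each at most 1.\<close>

lemma geo_triple_bounds:
  fixes a d m :: nat
  assumes "a > 0" "d > 0"
  defines "c \<equiv> fps_nth (geo a * geo (Suc a) * geo d)"
  shows "c m \<ge> (of_nat m)\<^sup>2 / (2 * of_nat (a * Suc a * d)) - of_nat m - 1" (is ?lower)
    and "c m \<le> (of_nat m)\<^sup>2 / (2 * of_nat (a * Suc a * d)) + 2 * of_nat m + 1" (is ?upper)
proof -
  define J where "J = m div d"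
  define p :: rat where "p = of_nat (a * Suc a)"
  define S :: rat where "S = (\<Sum>j\<le>J. of_nat (m - d * j))"
  have "1 * 1 \<le> a * Suc a" using assms by (intro mult_mono) auto
  then have p: "p \<ge> 1" unfolding p_def by (metis mult_1 of_nat_1 of_nat_mono)
  have dJ: "d * j \<le> m" if "j \<le> J" for j
    using that assms by (simp add: J_def less_eq_div_iff_mult_less_eq mult.commute)
  have c: "c m = (\<Sum>j\<le>J. fps_nth (geo a * geo (Suc a)) (m - d * j))"
    unfolding c_def J_def using assms by (intro mult_geo_nth) auto
  have "J \<le> m" by (simp add: J_def)
  then have Jm: "(of_nat J :: rat) \<le> of_nat m" by simp
  have "(\<Sum>j\<le>J. of_nat (m - d * j) / p - 1) \<le> c m"
    unfolding c p_def using assms by (intro sum_mono geo_mult_geo_Suc_bounds)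
  then have lo: "S / p - (of_nat J + 1) \<le> c m"
    by (simp add: S_def sum_subtractf sum_divide_distrib add.commute)
  have "c m \<le> (\<Sum>j\<le>J. of_nat (m - d * j) / p + 1)"
    unfolding c p_def using assms by (intro sum_mono geo_mult_geo_Suc_bounds)
  then have up: "c m \<le> S / p + (of_nat J + 1)"
    by (simp add: S_def sum.distrib sum_divide_distrib add.commute)
  define m' d' J' r :: rat where "m' = of_nat m" and "d' = of_nat d" and "J' = of_nat J"
    and "r = of_nat (m mod d)"
  have "m = d * J + m mod d" by (simp add: J_def)
  then have m': "m' = d' * J' + r"
    unfolding m'_def d'_def J'_def r_def by (metis of_nat_add of_nat_mult)
  have r: "0 \<le> r" "r \<le> d'" "r \<le> m'"
    using assms by (simp_all add: r_def d'_def m'_def less_imp_le)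
  have d': "d' \<ge> 1" using assms by (simp add: d'_def)
  have J': "J' \<ge> 0" by (simp add: J'_def)
  have gauss: "(\<Sum>j\<le>n. m' - d' * of_nat j) = (of_nat n + 1) * (m' - d' * of_nat n / 2)" for n
    by (induction n) (auto simp: field_simps)
  have "S = (\<Sum>j\<le>J. m' - d' * of_nat j)"
    unfolding S_def by (intro sum.cong) (auto simp: dJ of_nat_diff m'_def d'_def)
  then have S: "2 * d' * S = (m' - r + d') * (m' + r)"
    unfolding gauss by (simp add: m' J'_def algebra_simps)
  \<comment> \<open>The product in \<open>S\<close> expands to m'^2 + d' m' + r (d' - r).\<close>
  have "0 \<le> r * (d' - r)" "r * (d' - r) \<le> m' * d'" "0 \<le> m' * d'"
    using r d' by (auto intro!: mult_mono)
  then have "m'\<^sup>2 \<le> 2 * d' * S" "2 * d' * S \<le> m'\<^sup>2 + 2 * (d' * m')"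
    unfolding S by (simp_all add: algebra_simps power2_eq_square)
  then have S_bounds: "m'\<^sup>2 / (2 * d') \<le> S" "S \<le> m'\<^sup>2 / (2 * d') + m'"
    using d' by (simp_all add: field_simps)
  have pd: "m'\<^sup>2 / (2 * of_nat (a * Suc a * d)) = m'\<^sup>2 / (2 * d') / p"
    by (simp add: p_def d'_def mult_ac)
  have "m'\<^sup>2 / (2 * d') / p \<le> S / p" "S / p \<le> (m'\<^sup>2 / (2 * d') + m') / p"
    using S_bounds p by (simp_all only: divide_right_mono)
  moreover have "m' / p \<le> m'"
    using p by (simp add: m'_def divide_le_eq mult_left_mono[of 1 p, simplified] mult_le_cancel_left1)
  ultimately show ?lower ?upper
    using lo up Jm unfolding m'_def[symmetric] pd by (simp_all add: add_divide_distrib)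
qed

text \<open>As L >= s + 1, the leading coefficients differ by at least 1 / (2 p s) - 1 / (2 p (s +
  1)) = 1 / (2 p s (s + 1)), which does not involve L. Shifting by s changes only lower-order
  terms.\<close>

lemma quadratic_gap:
  fixes t u :: "rat fps" and p s L :: nat
  assumes "p > 0" "s > 0" "s < L"
    and t: "\<And>m. fps_nth t m \<ge> (of_nat m)\<^sup>2 / (2 * of_nat (p * s)) - of_nat m - 1"
    and u: "\<And>m. fps_nth u m \<le> (of_nat m)\<^sup>2 / (2 * of_nat (p * L)) + 2 * of_nat m + 1"
  shows "fps_nth (fps_X ^ s * t - u) m
    \<ge> (of_nat m)\<^sup>2 / of_nat (2 * p * s * (s + 1)) - 4 * of_nat m - 2"
proof -
  define p' s' L' x :: rat where "p' = of_nat p" and "s' = of_nat s" and "L' = of_nat L"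
    and "x = of_nat m"
  have "s + 1 \<le> L" using assms by simp
  then have sL: "s' + 1 \<le> L'"
    unfolding s'_def L'_def by (metis of_nat_1 of_nat_add of_nat_mono)
  have pos: "p' \<ge> 1" "s' \<ge> 1" "x \<ge> 0"
    using assms by (simp_all add: p'_def s'_def x_def)
  have "x\<^sup>2 / (2 * (p' * L')) \<le> x\<^sup>2 / (2 * (p' * (s' + 1)))"
    using pos sL by (intro divide_left_mono mult_left_mono) auto
  also have "\<dots> = x\<^sup>2 / (2 * (p' * s')) - x\<^sup>2 / (2 * p' * s' * (s' + 1))"
    using pos by (simp add: divide_simps) (simp add: algebra_simps)
  finally have gap: "x\<^sup>2 / (2 * (p' * L'))
      \<le> x\<^sup>2 / (2 * (p' * s')) - x\<^sup>2 / (2 * p' * s' * (s' + 1))" .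
  have u': "fps_nth u m \<le> x\<^sup>2 / (2 * (p' * L')) + 2 * x + 1"
    using u[of m] by (simp add: p'_def L'_def x_def)
  have "fps_nth (fps_X ^ s * t) m \<ge> x\<^sup>2 / (2 * (p' * s')) - 2 * x - 1"
  \<comment> \<open>Below s the shifted coefficient is 0, and the claimed bound is negative because
    x^2 / (2 p' s') <= 2 x there.\<close>
  proof (cases "m < s")
    case True
    then have "x \<le> s'" by (simp add: x_def s'_def)
    moreover have "s' \<le> p' * s'" using pos by simp
    ultimately have "x \<le> p' * s'" by linarith
    then have "x * x \<le> x * (p' * s')" using pos by (intro mult_left_mono)
    then have "x\<^sup>2 \<le> (2 * x) * (2 * (p' * s'))"
      using pos zero_le_mult_iff[of x x] unfolding power2_eq_square by linarith
    then have "x\<^sup>2 / (2 * (p' * s')) \<le> 2 * x"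
      using pos by (simp add: pos_divide_le_eq)
    then show ?thesis using True by (simp add: fps_X_power_mult_nth)
  next
    case False
    have "of_nat (m - s) = x - s'"
      using False by (simp add: x_def s'_def of_nat_diff)
    then have "fps_nth (fps_X ^ s * t) m \<ge> (x - s')\<^sup>2 / (2 * (p' * s')) - (x - s') - 1"
      using t[of "m - s"] False by (simp add: fps_X_power_mult_nth p'_def s'_def)
    moreover have "(x - s')\<^sup>2 / (2 * (p' * s')) \<ge> x\<^sup>2 / (2 * (p' * s')) - x"
    proof -
      have "1 * (x * s') \<le> p' * (x * s')" using pos by (intro mult_right_mono) auto
      then have "x\<^sup>2 - x * (2 * (p' * s')) \<le> (x - s')\<^sup>2"
        by (simp add: power2_diff algebra_simps add_increasing)
      then have "(x\<^sup>2 - x * (2 * (p' * s'))) / (2 * (p' * s')) \<le> (x - s')\<^sup>2 / (2 * (p' * s'))"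
        using pos by (intro divide_right_mono) auto
      then show ?thesis using pos by (simp add: diff_divide_distrib)
    qed
    ultimately show ?thesis using pos by linarith
  qed
  moreover have "of_nat (2 * p * s * (s + 1)) = 2 * p' * s' * (s' + 1)"
    by (simp add: p'_def s'_def algebra_simps)
  ultimately show ?thesis
    using gap u' unfolding x_def[symmetric] by simp
qed

text \<open>
  The pair is consecutive except for \<open>s = 1, L = 3\<close>, where \<open>S = {2, 4}\<close> forces \<open>a = 2, b = 4\<close>;
  there the consecutive pairs \<open>1, 2\<close> and \<open>2, 3\<close> arise by including \<open>s\<close> and \<open>L\<close>, respectively.
\<close>

lemma exists_pair_quadratic_gap:
  assumes "s > 0" "L \<ge> 3" "s < L"
  shows "\<exists>a b. a \<noteq> b \<and> {a, b} \<subseteq> {s + 1..s + L} - {L} \<and> a * b \<le> (s + 4)\<^sup>2 \<and>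
    (\<forall>m. fps_nth (fps_X ^ s * (geo a * geo b * geo s) - geo a * geo b * geo L) m
      \<ge> (of_nat m)\<^sup>2 / of_nat (2 * (a * b) * s * (s + 1)) - 4 * of_nat m - 2)"
proof (cases "s = 1 \<and> L = 3")
  case True
  \<comment> \<open>Both triples fit p = 8: 1 * 2 * 4 = 8 s and 2 * 3 * 4 = 8 L.\<close>
  have "fps_nth (fps_X ^ s * (geo 1 * geo (Suc 1) * geo 4) - geo 2 * geo (Suc 2) * geo 4) m
      \<ge> (of_nat m)\<^sup>2 / of_nat (2 * (2 * 4) * s * (s + 1)) - 4 * of_nat m - 2" for m
    using True geo_triple_bounds[of 1 4] geo_triple_bounds[of 2 4]
    by (intro quadratic_gap[where L = L]) simp_all
  then show ?thesis
    using True by (intro exI[of _ 2] exI[of _ 4])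
      (simp add: mult_ac numeral_eq_Suc power2_eq_square)
next
  case False
  \<comment> \<open>Each choice keeps L out of {a, a + 1}. For L = s + 2 the part s + 4 is available
    because the excluded case leaves L >= 4.\<close>
  define a where "a = (if L = s + 1 then s + 2 else if L = s + 2 then s + 3 else s + 1)"
  have "fps_nth (fps_X ^ s * (geo a * geo (Suc a) * geo s) - geo a * geo (Suc a) * geo L) m
      \<ge> (of_nat m)\<^sup>2 / of_nat (2 * (a * Suc a) * s * (s + 1)) - 4 * of_nat m - 2" for m
    using assms by (intro quadratic_gap[where L = L] geo_triple_bounds) (auto simp: a_def)
  moreover have "{a, Suc a} \<subseteq> {s + 1..s + L} - {L}"
    using assms False by (auto simp: a_def)
  moreover have "a * Suc a \<le> (s + 4) * (s + 4)"
    by (intro mult_mono) (auto simp: a_def)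
  ultimately show ?thesis
    by (intro exI[of _ a] exI[of _ "Suc a"]) (auto simp: power2_eq_square)
qed

section \<open>Factoring \<open>H\<close>\<close>

lemma divide_qpoch:
  assumes "a > 0"
  shows "f / qpoch (fps_X ^ a) fps_X n = f * prod geo {a..<a + n}"
proof -
  have "prod geo {a..<a + n} = (\<Prod>i<n. geo (a + i))"
    by (rule prod.reindex_bij_witness[of _ "\<lambda>i. a + i" "\<lambda>i. i - a"]) auto
  then have "prod geo {a..<a + n} * qpoch (fps_X ^ a) fps_X n
      = (\<Prod>i<n. geo (a + i) * (1 - fps_X ^ (a + i)))"
    by (simp add: qpoch_def power_add prod.distrib)
  also have "\<dots> = 1"
    using assms by (intro prod.neutral) (simp add: geo_mult_one_minus)
  finally have inv: "prod geo {a..<a + n} * qpoch (fps_X ^ a) fps_X n = 1" .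
  then have "qpoch (fps_X ^ a) fps_X n \<noteq> (0 :: rat fps)" by auto
  moreover have "f = f * prod geo {a..<a + n} * qpoch (fps_X ^ a) fps_X n"
    by (simp add: mult.assoc inv)
  ultimately show ?thesis
    by (metis nonzero_mult_div_cancel_right)
qed

text \<open>Since s < L, both products contain \<open>geo L\<close>. In the first it cancels against
  1 - q^L; in the second it survives. The parts other than s, L, a, b form a common factor.\<close>

lemma H_eq:
  assumes "s > 0" "s < L" "a \<noteq> b" "{a, b} \<subseteq> {s + 1..s + L} - {L}"
  shows "H L s L = 1 + (fps_X ^ s * (geo a * geo b * geo s) - geo a * geo b * geo L)
    * prod geo ({s + 1..s + L} - {L, a, b})"
proof -
  define R where "R = {s + 1..s + L} - {L, a, b}"
  have fin: "finite R" by (simp add: R_def)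
  have "{s..<s + (L + 1)} = insert s (insert L (insert a (insert b R)))"
    using assms by (auto simp: R_def)
  moreover have "s \<notin> insert L (insert a (insert b R))" "L \<notin> insert a (insert b R)"
      "a \<notin> insert b R" "b \<notin> R"
    using assms by (auto simp: R_def)
  ultimately have p1: "prod geo {s..<s + (L + 1)} = geo s * (geo L * (geo a * (geo b * prod geo R)))"
    using fin by simp
  have "{s + 1..<s + 1 + L} = insert L (insert a (insert b R))"
    using assms by (auto simp: R_def)
  moreover have "L \<notin> insert a (insert b R)" "a \<notin> insert b R" "b \<notin> R"
    using assms by (auto simp: R_def)
  ultimately have p2: "prod geo {s + 1..<s + 1 + L} = geo L * (geo a * (geo b * prod geo R))"
    using fin by simp
  have "H L s L = fps_X ^ s * (1 - fps_X ^ L) * (geo s * (geo L * (geo a * (geo b * prod geo R))))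
      - (geo L * (geo a * (geo b * prod geo R)) - 1)"
    unfolding H_def using assms divide_qpoch[of s _ "L + 1"] divide_qpoch[of "s + 1" 1 L] p1 p2
    by simp
  also have "\<dots> = 1 + (fps_X ^ s * (geo a * geo b * geo s) * (geo L * (1 - fps_X ^ L))
      - geo a * geo b * geo L) * prod geo R"
    by (simp add: algebra_simps)
  finally show ?thesis
    using assms by (simp add: geo_mult_one_minus R_def)
qed

section \<open>The threshold and the conclusion\<close>

text \<open>The left side is 6247 (2 (s + 4)^4)^6, the threshold of
  \<open>mult_prod_geo_nth_ge\<close> for the largest possible \<kappa>. The first five factors of
  \<open>P\<close> already give Q >= 720 and Q >= s + 4, so Q^26 exceeds it, and the exponent in
  \<open>gamma_bound\<close> is at least 26.\<close>

lemma Gamma_bound_ge: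
  assumes "s > 0"
  shows "int (399808 * (s + 4) ^ 24) \<le> Gamma_bound s"
proof -
  define L where "L = 3 * s + 2"
  define Q where "Q = P L s"
  have split: "{1..L} = {1..5} \<union> {6..L}" using assms by (auto simp: L_def)
  have "Q = (\<Prod>i=1..5. s + i) * (\<Prod>i=6..L. s + i)"
    unfolding Q_def P_def split by (rule prod.union_disjoint) auto
  moreover have "(\<Prod>i=6..L. s + i) \<ge> 1" by (rule prod_ge_1) simp
  ultimately have Q_ge: "(\<Prod>i=1..5. s + i) \<le> Q" by simp
  have five: "(\<Prod>i=1..5. s + i) = (s + 1) * (s + 2) * (s + 3) * (s + 4) * (s + 5)"
    by (simp add: numeral_eq_Suc)
  have "2 * 3 * 4 * 5 * 6 \<le> (s + 1) * (s + 2) * (s + 3) * (s + 4) * (s + 5)"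
    using assms by (intro mult_mono) auto
  then have Q720: "720 \<le> Q" using Q_ge five by simp
  have "1 * 1 * 1 * (s + 4) * 1 \<le> (s + 1) * (s + 2) * (s + 3) * (s + 4) * (s + 5)"
    by (intro mult_mono) auto
  then have Qs: "s + 4 \<le> Q" using Q_ge unfolding five mult_1 mult_1_right by (rule le_trans)
  have "(399808::nat) \<le> 720\<^sup>2" by simp
  also have "\<dots> \<le> Q\<^sup>2" using Q720 by (intro power_mono) auto
  finally have "399808 * (s + 4) ^ 24 \<le> Q\<^sup>2 * Q ^ 24"
    using Qs by (intro mult_mono power_mono) auto
  also have "\<dots> = Q ^ 26" by (simp flip: power_add)
  also have "\<dots> \<le> Q ^ ((Q\<^sup>2 - 1) * L + 2)"
  proof (rule power_increasing)
    have "720\<^sup>2 \<le> Q\<^sup>2" using Q720 by (intro power_mono) auto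
    then have "24 * 1 \<le> (Q\<^sup>2 - 1) * L" by (intro mult_mono) (auto simp: L_def)
    then show "26 \<le> (Q\<^sup>2 - 1) * L + 2" by simp
  qed (use Q720 in auto)
  finally have main: "int (399808 * (s + 4) ^ 24) \<le> int Q ^ ((Q\<^sup>2 - 1) * L + 2)"
    by (metis of_nat_le_iff of_nat_power)
  have "720\<^sup>2 \<le> (int Q)\<^sup>2" using Q720 by (intro power_mono) auto
  then have "2 * 1 \<le> ((int Q)\<^sup>2 - 1) * int L" by (intro mult_mono) (use Q720 in \<open>auto simp: L_def\<close>)
  then have "0 \<le> (((int Q)\<^sup>2 - 1) * int L - 2) * int Q"
    by (intro mult_nonneg_nonneg) auto
  then have "int (399808 * (s + 4) ^ 24)
      \<le> int Q ^ ((Q\<^sup>2 - 1) * L + 2) + (((int Q)\<^sup>2 - 1) * int L - 2) * int Q"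
    using main by linarith
  moreover have "1 \<le> int (\<Sum>i=1..L. s + i)"
  proof -
    have "s + 1 \<le> (\<Sum>i=1..L. s + i)"
      by (rule member_le_sum) (auto simp: L_def)
    then show ?thesis by linarith
  qed
  ultimately have "1 * int (399808 * (s + 4) ^ 24) \<le> int (\<Sum>i=1..L. s + i) *
      (int Q ^ ((Q\<^sup>2 - 1) * L + 2) + (((int Q)\<^sup>2 - 1) * int L - 2) * int Q)"
    by (intro mult_mono) auto
  then show ?thesis
    by (simp add: Gamma_bound_def gamma_bound_def L_def Q_def)
qed

theorem theorem8:
  fixes L s N :: nat
  assumes "L > 0" and "s > 0"
    and "L \<ge> 3" and "L \<ge> s + 1"
    and "int N \<ge> Gamma_bound s"
  shows "fps_nth (H L s L) N \<ge>
    of_int \<lfloor>(of_nat N - 10 * of_nat s) / of_nat ((s + 2) * (s + 3)) :: rat\<rfloor>"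
proof -
  obtain a b where ab: "a \<noteq> b" "{a, b} \<subseteq> {s + 1..s + L} - {L}" "a * b \<le> (s + 4)\<^sup>2"
    and gap: "\<And>m. fps_nth (fps_X ^ s * (geo a * geo b * geo s) - geo a * geo b * geo L) m
      \<ge> (of_nat m)\<^sup>2 / of_nat (2 * (a * b) * s * (s + 1)) - 4 * of_nat m - 2"
    using exists_pair_quadratic_gap[of s L] assms by auto
  define R where "R = {s + 1..s + L} - {L, a, b}"
  define \<kappa> where "\<kappa> = 2 * (a * b) * s * (s + 1)"
  have "\<kappa> > 0" using ab assms by (auto simp: \<kappa>_def)
  then have \<kappa>: "\<kappa> \<ge> 1" by simp
  \<comment> \<open>This bound depends on s alone, so one threshold serves every L.\<close>
  have "\<kappa> \<le> 2 * (s + 4)\<^sup>2 * (s + 4) * (s + 4)"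
    unfolding \<kappa>_def using ab by (intro mult_mono) auto
  then have "\<kappa> ^ 6 \<le> (2 * (s + 4) ^ 4) ^ 6"
    by (intro power_mono) (simp_all add: power2_eq_square power4_eq_xxxx mult_ac)
  then have "6247 * \<kappa> ^ 6 \<le> 399808 * (s + 4) ^ 24"
    by (simp add: power_mult_distrib flip: power_mult)
  then have N: "6247 * \<kappa> ^ 6 \<le> N"
    using Gamma_bound_ge[of s] assms by linarith
  have "of_nat N \<le> fps_nth ((fps_X ^ s * (geo a * geo b * geo s) - geo a * geo b * geo L)
      * prod geo R) N"
    using gap \<kappa> N by (intro mult_prod_geo_nth_ge[where \<kappa> = \<kappa>]) (auto simp: R_def \<kappa>_def)
  then have HN: "of_nat N \<le> fps_nth (H L s L) N"
    unfolding R_def by (subst H_eq[of s L a b]) (use ab assms in \<open>simp_all add: add_increasing\<close>)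
  \<comment> \<open>The coefficient is at least N, and the floor is at most N: dropping 10 s and
    replacing the denominator by 1 only enlarge the quotient.\<close>
  have "of_int \<lfloor>(of_nat N - 10 * of_nat s) / of_nat ((s + 2) * (s + 3)) :: rat\<rfloor>
      \<le> (of_nat N - 10 * of_nat s) / (of_nat ((s + 2) * (s + 3)) :: rat)"
    by (rule of_int_floor_le)
  also have "\<dots> \<le> of_nat N / of_nat ((s + 2) * (s + 3))"
    by (intro divide_right_mono) auto
  also have "\<dots> \<le> of_nat N / 1"
    by (intro divide_left_mono) (auto simp: algebra_simps add_pos_nonneg)
  finally show ?thesis using HN by simp
qed

end
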